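(* There exists a parabolic one-parameter semigroup $(\varphi_t)_{t\ge 0}$ of holomorphic self-maps of the unit disc $\mathbb{D}$ with Denjoy–Wolff point $\tau=1$ such that $$\mathrm{Slope}^{+}(\varphi_t(z),1)=\left[-\frac{\pi}{2},\frac{\pi}{2}\right]\quad\text{for each } z\in\mathbb{D}.$$ In particular, the following assertion (the "Parabolic Slope Conjecture") is false: for every parabolic one-parameter semigroup $(\varphi_t)$ in $\mathbb{D}$ with Denjoy–Wolff point $\tau\in\partial\mathbb{D}$ there exists $\theta\in[-\pi/2,\pi/2]$ such that $\mathrm{Slope}^{+}(\varphi_t(z),\tau)=\{\theta\}$ for all $z\in\mathbb{D}$.
   Context: Let $\mathbb{D}=\{z\in\mathbb{C}: |z|<1\}$ and let $\mathrm{Hol}(\mathbb{D},\mathbb{D})$ be the semigroup (under composition) of all holomorphic self-maps of $\mathbb{D}$, endowed with the topology of uniform convergence on compact sets. A one-parameter semigroup of holomorphic functions in $\mathbb{D}$ is a continuous homomorphism $t\mapsto\varphi_t$ from the additive semigroup $[0,+\infty)$ (with the Euclidean topology) into $\mathrm{Hol}(\mathbb{D},\mathbb{D})$; that is, $\varphi_0=\mathrm{id}_{\mathbb{D}}$, $\varphi_{t+s}=\varphi_t\circ\varphi_s$ for all $s,t\ge 0$, and $t\mapsto\varphi_t$ is continuous. Denjoy–Wolff point: if $(\varphi_t)$ is a one-parameter semigroup such that $\varphi_{t_0}$ has no fixed point in $\mathbb{D}$ for some $t_0>0$, then (continuous Denjoy–Wolff theorem) there is a unique point $\tau\in\partial\mathbb{D}$,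 called the Denjoy–Wolff point of $(\varphi_t)$, such that $\lim_{t\to+\infty}\varphi_t(z)=\tau$ for every $z\in\mathbb{D}$. Moreover, there is $\lambda\ge 0$ such that $\lim_{r\to 1^-}\varphi_t'(r\tau)=e^{-\lambda t}$ for all $t\ge 0$. Such a semigroup is called hyperbolic if $\lambda>0$ and parabolic if $\lambda=0$. Set of slopes: for a hyperbolic or parabolic semigroup $(\varphi_t)$ with Denjoy–Wolff point $\tau\in\partial\mathbb{D}$ and for $z\in\mathbb{D}$, $\mathrm{Slope}^{+}(\varphi_t(z),\tau)$ denotes the $\omega$-limit set of the curve $[0,+\infty)\ni t\mapsto \mathrm{Arg}(1-\overline{\tau}\varphi_t(z))\in(-\pi/2,\pi/2)$, where $\mathrm{Arg}$ is the principal argument. That is, $\mathrm{Slope}^{+}(\varphi_t(z),\tau)$ is the set of all $\theta\in[-\pi/2,\pi/2]$ for which there is a strictly increasing sequence $(t_n)\subset(0,+\infty)$ with $t_n\to+\infty$ and $\mathrm{Arg}(1-\overline{\tau}\varphi_{t_n}(z))\to\theta$. *)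

theory Defs
  imports "HOL-Complex_Analysis.Complex_Analysis"
begin

abbreviation unit_disc :: "complex set" (\<open>\<D>\<close>)
  where "\<D> \<equiv> ball 0 1"

text \<open>
  A self-map of the disc is represented by a total function \<^typ>\<open>complex \<Rightarrow> complex\<close> of which
  only the values on \<open>\<D>\<close> matter, and a family of them by \<open>\<phi> :: real \<Rightarrow> complex \<Rightarrow> complex\<close> of which
  only the times \<open>t \<ge> 0\<close> matter.
\<close>

definition Hol_disc :: "(complex \<Rightarrow> complex) set"
  where "Hol_disc = {f. f holomorphic_on \<D> \<and> f ` \<D> \<subseteq> \<D>}"

text \<open>
  The last conjunct is continuity of \<open>t \<mapsto> \<phi> t\<close> on \<open>[0,\<infinity>)\<close> for the topology of uniform
  convergence on compact subsets of \<open>\<D>\<close>.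
\<close>

definition one_parameter_semigroup :: "(real \<Rightarrow> complex \<Rightarrow> complex) \<Rightarrow> bool"
  where "one_parameter_semigroup \<phi> \<longleftrightarrow>
    (\<forall>t\<ge>0. \<phi> t \<in> Hol_disc) \<and>
    (\<forall>z\<in>\<D>. \<phi> 0 z = z) \<and>
    (\<forall>s\<ge>0. \<forall>t\<ge>0. \<forall>z\<in>\<D>. \<phi> (t + s) z = \<phi> t (\<phi> s z)) \<and>
    (\<forall>t\<^sub>0\<ge>0. \<forall>K. compact K \<and> K \<subseteq> \<D> \<longrightarrow>
        uniform_limit K \<phi> (\<phi> t\<^sub>0) (at t\<^sub>0 within {0..}))"

definition nonelliptic_semigroup :: "(real \<Rightarrow> complex \<Rightarrow> complex) \<Rightarrow> bool"
  where "nonelliptic_semigroup \<phi> \<longleftrightarrow>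
    one_parameter_semigroup \<phi> \<and> (\<exists>t\<^sub>0>0. \<not> (\<exists>z\<in>\<D>. \<phi> t\<^sub>0 z = z))"

text \<open>
  Intended for non-elliptic semigroups, for which exactly one such \<open>\<tau>\<close> exists by the continuous
  Denjoy--Wolff theorem; uniqueness alone is just uniqueness of limits.
\<close>

definition Denjoy_Wolff_point :: "(real \<Rightarrow> complex \<Rightarrow> complex) \<Rightarrow> complex \<Rightarrow> bool"
  where "Denjoy_Wolff_point \<phi> \<tau> \<longleftrightarrow>
    \<tau> \<in> frontier \<D> \<and> (\<forall>z\<in>\<D>. ((\<lambda>t. \<phi> t z) \<longlongrightarrow> \<tau>) at_top)"

definition spectral_value :: "(real \<Rightarrow> complex \<Rightarrow> complex) \<Rightarrow> complex \<Rightarrow> real \<Rightarrow> bool"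
  where "spectral_value \<phi> \<tau> l \<longleftrightarrow> l \<ge> 0 \<and>
    (\<forall>t\<ge>0. ((\<lambda>r::real. deriv (\<phi> t) (of_real r * \<tau>)) \<longlongrightarrow> of_real (exp (- l * t))) (at_left 1))"

definition parabolic_semigroup :: "(real \<Rightarrow> complex \<Rightarrow> complex) \<Rightarrow> bool"
  where "parabolic_semigroup \<phi> \<longleftrightarrow> nonelliptic_semigroup \<phi> \<and>
    (\<exists>\<tau>. Denjoy_Wolff_point \<phi> \<tau> \<and> spectral_value \<phi> \<tau> 0)"

text \<open>
  The set \<open>Slope\<^sup>+(\<phi>\<^sub>t(z), \<tau>)\<close>. For \<open>\<tau>\<close> on the unit circle and \<open>\<phi> t z \<in> \<D>\<close> the number
  \<open>1 - cnj \<tau> * \<phi> t z\<close> has positive real part, so its \<^const>\<open>Arg\<close> lies in \<open>(-\<pi>/2, \<pi>/2)\<close>.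
\<close>

definition Slope_plus :: "(real \<Rightarrow> complex \<Rightarrow> complex) \<Rightarrow> complex \<Rightarrow> complex \<Rightarrow> real set"
  where "Slope_plus \<phi> z \<tau> = {\<theta> \<in> {- pi / 2 .. pi / 2}.
    \<exists>t :: nat \<Rightarrow> real. strict_mono t \<and> (\<forall>n. t n > 0) \<and> filterlim t at_top sequentially \<and>
      (\<lambda>n. Arg (1 - cnj \<tau> * \<phi> (t n) z)) \<longlonglongrightarrow> \<theta>}"

definition parabolic_slope_conjecture :: bool
  where "parabolic_slope_conjecture \<longleftrightarrow>
    (\<forall>\<phi> \<tau>. parabolic_semigroup \<phi> \<and> Denjoy_Wolff_point \<phi> \<tau> \<longrightarrow>
      (\<exists>\<theta>\<in>{- pi / 2 .. pi / 2}. \<forall>z\<in>\<D>. Slope_plus \<phi> z \<tau> = {\<theta>}))"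

end

theory Submission
  imports Defs
begin

text \<open>
  Put \<open>w = 6 / (1 - z)\<close>, which maps the disc onto the half-plane \<open>Re w > 3\<close> and satisfies
  \<open>Arg (1 - z) = - Arg w\<close>. On this half-plane take the Koenigs function
  \<open>h(w) = w (1 + \<i> p(Ln w))\<close> with \<open>p(l) = l sin (Ln l) / 100\<close>. The function \<open>p\<close> is real on the positive
  axis, where it oscillates with unbounded amplitude, but \<open>p'\<close> is uniformly small; hence
  \<open>h' = 1 + \<i> (p + p')\<close> has real part at least \<open>1/2\<close>. Therefore \<open>h\<close> is injective and expands
  distances by at least \<open>1/2\<close>, its image is invariant under \<open>u \<mapsto> u + t\<close>, and
  \<open>h\<^sup>-\<^sup>1 (h(w) + t)\<close> is a semigroup; \<open>h''(w) = O(1/w)\<close> makes it parabolic. Since \<open>Im h\<close>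
  is constant along a trajectory, its slope \<open>Im w / Re w\<close> is \<open>- p(ln |w|)\<close> up to bounded
  errors and factors. As \<open>|w|\<close> tends to infinity continuously, the slope takes every real value at
  arbitrarily late times.
\<close>

section \<open>The oscillating function and bounds for its derivatives\<close>

lemma norm_sin_cos_le:
  fixes z :: complex
  shows "norm (sin z) \<le> exp \<bar>Im z\<bar>" "norm (cos z) \<le> exp \<bar>Im z\<bar>"
proof -
  have "norm (exp (\<i> * z)) \<le> exp \<bar>Im z\<bar>" "norm (exp (- (\<i> * z))) \<le> exp \<bar>Im z\<bar>"
    by auto
  then have "norm (exp (\<i> * z) - exp (- (\<i> * z))) \<le> 2 * exp \<bar>Im z\<bar>"
    and "norm (exp (\<i> * z) + exp (- (\<i> * z))) \<le> 2 * exp \<bar>Im z\<bar>"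
    using norm_triangle_ineq4[of "exp (\<i> * z)" "exp (- (\<i> * z))"]
      norm_triangle_ineq[of "exp (\<i> * z)" "exp (- (\<i> * z))"] by linarith+
  then show "norm (sin z) \<le> exp \<bar>Im z\<bar>" "norm (cos z) \<le> exp \<bar>Im z\<bar>"
    by (simp_all add: sin_exp_eq cos_exp_eq norm_divide norm_mult)
qed

text \<open>On the right half-plane the imaginary part of the logarithm stays below pi/2 < 2 in
  modulus, so both functions are bounded by e^2 \<le> 9. This keeps \<open>osc'\<close> bounded
  although \<open>osc\<close> is not.\<close>

lemma norm_sin_cos_Ln_le:
  assumes "Re l > 0"
  shows "norm (sin (Ln l)) \<le> 9" "norm (cos (Ln l)) \<le> 9"
proof -
  have "l \<noteq> 0" using assms by auto
  then have "\<bar>Im (Ln l)\<bar> \<le> 2"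
    using assms Re_Ln_pos_lt[of l] pi_less_4 by auto
  then have "exp \<bar>Im (Ln l)\<bar> \<le> exp (2::real)" by simp
  also have "\<dots> = exp 1 ^ 2" by (simp flip: exp_of_nat_mult)
  also have "\<dots> \<le> (3::real)^2" by (intro power_mono exp_le) auto
  finally have "exp \<bar>Im (Ln l)\<bar> \<le> 9" by simp
  then show "norm (sin (Ln l)) \<le> 9" "norm (cos (Ln l)) \<le> 9"
    using norm_sin_cos_le[of "Ln l"] by linarith+
qed

text \<open>The divisor 100 makes \<open>osc'\<close> at most 18/100; with the bound 3/10 for
  \<open>Im (osc l)\<close> on the strip used below, this leaves 1 - 3/10 - 18/100 > 1/2 for the
  real part of \<open>koenigs'\<close>.\<close>

definition osc :: "complex \<Rightarrow> complex"
  where "osc l = l * sin (Ln l) / 100"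

definition osc' :: "complex \<Rightarrow> complex"
  where "osc' l = (sin (Ln l) + cos (Ln l)) / 100"

definition osc'' :: "complex \<Rightarrow> complex"
  where "osc'' l = (cos (Ln l) - sin (Ln l)) / (100 * l)"

lemma has_field_derivative_osc:
  assumes "Re l > 0"
  shows "(osc has_field_derivative osc' l) (at l)"
    and "(osc' has_field_derivative osc'' l) (at l)"
proof -
  have "l \<notin> \<real>\<^sub>\<le>\<^sub>0" "l \<noteq> 0" using assms by (auto simp: complex_nonpos_Reals_iff)
  then show "(osc has_field_derivative osc' l) (at l)"
    unfolding osc_def osc'_def
    by (auto intro!: derivative_eq_intros simp: field_simps)
  show "(osc' has_field_derivative osc'' l) (at l)"
    using \<open>l \<notin> \<real>\<^sub>\<le>\<^sub>0\<close> \<open>l \<noteq> 0\<close> unfolding osc'_def osc''_def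
    by (auto intro!: derivative_eq_intros simp: field_simps)
qed

lemma norm_osc'_le:
  assumes "Re l > 0"
  shows "norm (osc' l) \<le> 18 / 100"
  using norm_sin_cos_Ln_le[OF assms] norm_triangle_ineq[of "sin (Ln l)" "cos (Ln l)"]
  by (auto simp: osc'_def norm_divide)

lemma norm_osc''_le:
  assumes "Re l \<ge> 1"
  shows "norm (osc'' l) \<le> 18 / 100"
proof -
  have "norm (cos (Ln l) - sin (Ln l)) \<le> 18"
    using norm_sin_cos_Ln_le[of l] norm_triangle_ineq4[of "cos (Ln l)" "sin (Ln l)"] assms
    by auto
  moreover have "norm l \<ge> 1" using assms complex_Re_le_cmod[of l] by linarith
  ultimately have "norm (cos (Ln l) - sin (Ln l)) \<le> 18 * norm l" by linarith
  then have "norm (cos (Ln l) - sin (Ln l)) / (100 * norm l) \<le> 18 / 100"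
    using \<open>norm l \<ge> 1\<close> by (subst pos_divide_le_eq) auto
  then show ?thesis by (simp add: osc''_def norm_divide norm_mult)
qed

text \<open>Mean value inequality on the vertical segment from \<open>Re l\<close> to
  \<open>l\<close>: its length is at most pi/2, and 18/100 * pi/2 < 3/10. As \<open>osc\<close> is
  real on the positive axis, this controls its imaginary part and approximates its real part by the
  explicit real oscillation.\<close>

lemma osc_diff_Re_le:
  assumes "Re l > 0" "\<bar>Im l\<bar> \<le> pi / 2"
  shows "norm (osc l - osc (of_real (Re l))) \<le> 3 / 10"
proof -
  have "norm (osc l - osc (of_real (Re l))) \<le> 18 / 100 * norm (l - of_real (Re l))"
  proof (rule field_differentiable_bound)
    show "convex {l. Re l > 0}" by (rule convex_halfspace_Re_gt)
    show "(osc has_field_derivative osc' z) (at z within {l. Re l > 0})"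
      if "z \<in> {l. Re l > 0}" for z
      using that has_field_derivative_osc(1)[of z] has_field_derivative_at_within by blast
    show "norm (osc' z) \<le> 18 / 100" if "z \<in> {l. Re l > 0}" for z
      using that norm_osc'_le by auto
  qed (use assms in auto)
  also have "norm (l - of_real (Re l)) = \<bar>Im l\<bar>"
    by (simp add: cmod_def)
  finally show ?thesis using assms(2) pi_approx by (simp)
qed

lemma osc_of_real:
  assumes "x > 0"
  shows "osc (of_real x) = of_real (x * sin (ln x) / 100)"
  using assms by (simp add: osc_def Ln_of_real sin_of_real)

lemma abs_Im_osc_le:
  assumes "Re l > 0" "\<bar>Im l\<bar> \<le> pi / 2"
  shows "\<bar>Im (osc l)\<bar> \<le> 3 / 10"
  using osc_diff_Re_le[OF assms] abs_Im_le_cmod[of "osc l - osc (of_real (Re l))"] assms(1)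
  by (simp add: osc_of_real)

lemma Re_osc_near:
  assumes "Re l > 0" "\<bar>Im l\<bar> \<le> pi / 2"
  shows "\<bar>Re (osc l) - Re l * sin (ln (Re l)) / 100\<bar> \<le> 3 / 10"
  using osc_diff_Re_le[OF assms] abs_Re_le_cmod[of "osc l - osc (of_real (Re l))"] assms(1)
  by (simp add: osc_of_real)

section \<open>The Koenigs function on the half-plane\<close>

text \<open>The abscissa 3 exceeds e, so \<open>Ln\<close> maps this half-plane into
  \<open>Re l \<ge> 1\<close>, where the bounds for both \<open>osc'\<close> and
  \<open>osc''\<close> hold.\<close>

abbreviation hplane :: "complex set" (\<open>\<H>\<close>)
  where "\<H> \<equiv> {w. 3 < Re w}"

definition koenigs :: "complex \<Rightarrow> complex"
  where "koenigs w = w * (1 + \<i> * osc (Ln w))"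

definition koenigs' :: "complex \<Rightarrow> complex"
  where "koenigs' w = 1 + \<i> * (osc (Ln w) + osc' (Ln w))"

lemma open_hplane: "open \<H>" and convex_hplane: "convex \<H>"
  by (rule open_halfspace_Re_gt) (rule convex_halfspace_Re_gt)

lemma Ln_hplane:
  assumes "w \<in> \<H>"
  shows "w \<noteq> 0" "w \<notin> \<real>\<^sub>\<le>\<^sub>0" "Re (Ln w) = ln (norm w)" "Re (Ln w) \<ge> 1" "\<bar>Im (Ln w)\<bar> \<le> pi / 2"
proof -
  show w: "w \<noteq> 0" "w \<notin> \<real>\<^sub>\<le>\<^sub>0" using assms by (auto simp: complex_nonpos_Reals_iff)
  then show "Re (Ln w) = ln (norm w)" by simp
  have "norm w \<ge> 3" using assms complex_Re_le_cmod[of w] by auto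
  then have "exp 1 \<le> norm w" using exp_le by linarith
  then show "Re (Ln w) \<ge> 1" using w by (simp add: ln_ge_iff)
  show "\<bar>Im (Ln w)\<bar> \<le> pi / 2" using assms Re_Ln_pos_lt[of w] w by auto
qed

lemma has_field_derivative_koenigs:
  assumes "w \<in> \<H>"
  shows "(koenigs has_field_derivative koenigs' w) (at w)"
    and "(koenigs' has_field_derivative \<i> * (osc' (Ln w) + osc'' (Ln w)) / w) (at w)"
proof -
  note L = Ln_hplane[OF assms]
  have "Re (Ln w) > 0" using L(4) by linarith
  note D = has_field_derivative_osc[OF this]
  have Ln: "(Ln has_field_derivative 1 / w) (at w)"
    using L by (auto intro!: derivative_eq_intros simp: field_simps)
  have o: "((\<lambda>w. osc (Ln w)) has_field_derivative osc' (Ln w) * (1 / w)) (at w)"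
    and o': "((\<lambda>w. osc' (Ln w)) has_field_derivative osc'' (Ln w) * (1 / w)) (at w)"
    using DERIV_chain2[OF D(1) Ln] DERIV_chain2[OF D(2) Ln] .
  show "(koenigs has_field_derivative koenigs' w) (at w)"
    unfolding koenigs_def koenigs'_def using L(1)
    by (auto intro!: derivative_eq_intros o simp: field_simps)
  show "(koenigs' has_field_derivative \<i> * (osc' (Ln w) + osc'' (Ln w)) / w) (at w)"
    unfolding koenigs'_def using L(1)
    by (auto intro!: derivative_eq_intros o o' simp: field_simps)
qed

lemma Re_koenigs'_ge:
  assumes "w \<in> \<H>"
  shows "Re (koenigs' w) \<ge> 1 / 2"
proof -
  note L = Ln_hplane[OF assms]
  have "Re (Ln w) > 0" using L(4) by linarith
  then show ?thesis
    using abs_Im_osc_le[of "Ln w"] norm_osc'_le[of "Ln w"] abs_Im_le_cmod[of "osc' (Ln w)"] L(5)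
    by (simp add: koenigs'_def)
qed

text \<open>The second derivative is at most 1/|w|, so \<open>koenigs'\<close> varies little far to
  the right. This is the source of parabolicity.\<close>

lemma koenigs'_diff_le:
  assumes "c > 3" "Re a \<ge> c" "Re b \<ge> c"
  shows "norm (koenigs' b - koenigs' a) \<le> 1 / c * norm (b - a)"
proof (rule field_differentiable_bound)
  show "convex {w. Re w \<ge> c}" by (rule convex_halfspace_Re_ge)
  fix w assume w: "w \<in> {w. Re w \<ge> c}"
  then have wH: "w \<in> \<H>" using assms by auto
  show "(koenigs' has_field_derivative \<i> * (osc' (Ln w) + osc'' (Ln w)) / w)
      (at w within {w. Re w \<ge> c})"
    by (rule has_field_derivative_at_within[OF has_field_derivative_koenigs(2)[OF wH]])
  have "Re (Ln w) \<ge> 1" using Ln_hplane[OF wH] by blast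
  then have "norm (osc' (Ln w) + osc'' (Ln w)) \<le> 1"
    using norm_osc'_le[of "Ln w"] norm_osc''_le[of "Ln w"]
      norm_triangle_ineq[of "osc' (Ln w)" "osc'' (Ln w)"] by linarith
  moreover have "norm w \<ge> c" using w complex_Re_le_cmod[of w] by auto
  ultimately show "norm (\<i> * (osc' (Ln w) + osc'' (Ln w)) / w) \<le> 1 / c"
    using assms(1) by (auto simp: norm_divide norm_mult intro!: frac_le)
qed (use assms in auto)

section \<open>Expansion, injectivity and translation invariance of the image\<close>

text \<open>The mean value theorem holds only for real parts of holomorphic functions. Multiplying
  by the constant \<open>cnj (b - a)\<close> first turns the derivative term into
  \<open>koenigs' u\<close> times |b - a|^2, whose real part is bounded below.\<close>

lemma koenigs_monotone:
  assumes "a \<in> \<H>" "b \<in> \<H>"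
  shows "(norm (b - a))\<^sup>2 / 2 \<le> Re ((koenigs b - koenigs a) * cnj (b - a))"
proof -
  have seg: "closed_segment a b \<subseteq> \<H>"
    using assms convex_hplane by (simp add: closed_segment_subset)
  have "\<exists>u. u \<in> closed_segment a b \<and>
      Re (koenigs b * cnj (b - a)) - Re (koenigs a * cnj (b - a))
        = Re ((koenigs' u * cnj (b - a)) * (b - a))"
    by (rule complex_mvt_line)
      (use seg in \<open>auto intro!: DERIV_cmult_right has_field_derivative_koenigs simp del: complex_cnj_diff\<close>)
  then obtain u where u: "u \<in> \<H>" and eq: "Re (koenigs b * cnj (b - a)) - Re (koenigs a * cnj (b - a))
        = Re ((koenigs' u * cnj (b - a)) * (b - a))"
    using seg by blast
  have prod: "(koenigs' u * cnj (b - a)) * (b - a) = koenigs' u * of_real ((norm (b - a))\<^sup>2)"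
    by (simp only: complex_norm_square mult_ac)
  have "Re ((koenigs' u * cnj (b - a)) * (b - a)) = Re (koenigs' u) * (norm (b - a))\<^sup>2"
    unfolding prod times_complex.sel Re_complex_of_real Im_complex_of_real by simp
  with eq have "Re ((koenigs b - koenigs a) * cnj (b - a)) = Re (koenigs' u) * (norm (b - a))\<^sup>2"
    by (simp only: left_diff_distrib minus_complex.sel)
  moreover have "1 / 2 * (norm (b - a))\<^sup>2 \<le> Re (koenigs' u) * (norm (b - a))\<^sup>2"
    by (rule mult_right_mono[OF Re_koenigs'_ge[OF u]]) simp
  ultimately show ?thesis by simp
qed

lemma koenigs_expansive:
  assumes "a \<in> \<H>" "b \<in> \<H>"
  shows "norm (b - a) \<le> 2 * norm (koenigs b - koenigs a)"
proof (cases "a = b")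
  case False
  have "norm (b - a) * norm (b - a) \<le> 2 * Re ((koenigs b - koenigs a) * cnj (b - a))"
    using koenigs_monotone[OF assms] by (simp add: power2_eq_square)
  also have "\<dots> \<le> 2 * (norm (koenigs b - koenigs a) * norm (b - a))"
    using complex_Re_le_cmod[of "(koenigs b - koenigs a) * cnj (b - a)"]
    by (simp add: norm_mult del: complex_cnj_diff)
  finally show ?thesis using False by simp
qed simp

lemma inj_on_koenigs: "inj_on koenigs \<H>"
proof (rule inj_onI)
  fix a b assume "a \<in> \<H>" "b \<in> \<H>" "koenigs a = koenigs b"
  then show "a = b" using koenigs_expansive[of a b] by simp
qed

lemma holomorphic_koenigs: "koenigs holomorphic_on \<H>"
  using has_field_derivative_koenigs(1) open_hplane
  by (auto simp: holomorphic_on_open)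

lemma open_koenigs_image: "open (koenigs ` \<H>)"
  using open_mapping_thm3[OF holomorphic_koenigs open_hplane inj_on_koenigs] .

text \<open>By expansion, preimages of a convergent sequence form a Cauchy sequence; their limit
  stays in the closed half-plane, where \<open>koenigs\<close> is continuous because c > 3.\<close>

lemma closed_koenigs_image:
  assumes "c > 3"
  shows "closed (koenigs ` {w. Re w \<ge> c})"
  unfolding closed_sequential_limits
proof (intro allI impI, elim conjE)
  fix x l assume x: "\<forall>n. x n \<in> koenigs ` {w. c \<le> Re w}" and l: "x \<longlonglongrightarrow> l"
  then obtain w where w: "\<And>n. Re (w n) \<ge> c" "\<And>n. x n = koenigs (w n)"
    by (simp add: image_iff) metis
  have wH: "w n \<in> \<H>" for n using w(1)[of n] assms by auto
  have "Cauchy w"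
  proof (rule CauchyI)
    fix e :: real assume "e > 0"
    have "Cauchy x" using l LIMSEQ_imp_Cauchy by blast
    then obtain M where M: "\<And>m n. m \<ge> M \<Longrightarrow> n \<ge> M \<Longrightarrow> norm (x m - x n) < e / 2"
      using CauchyD[of x "e / 2"] \<open>e > 0\<close> by auto
    have "norm (w m - w n) < e" if "m \<ge> M" "n \<ge> M" for m n
      using M[OF that] koenigs_expansive[OF wH[of n] wH[of m]] w(2) by auto
    then show "\<exists>M. \<forall>m\<ge>M. \<forall>n\<ge>M. norm (w m - w n) < e" by blast
  qed
  then obtain v where v: "w \<longlonglongrightarrow> v" using Cauchy_convergent convergent_def by blast
  have "Re v \<ge> c"
    using tendsto_Re[OF v] w(1) by (auto intro: LIMSEQ_le_const)
  then have "isCont koenigs v"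
    using has_field_derivative_koenigs(1)[of v] assms by (auto intro: DERIV_isCont)
  then have "(\<lambda>n. koenigs (w n)) \<longlonglongrightarrow> koenigs v" using v isCont_tendsto_compose by blast
  then have "l = koenigs v" using LIMSEQ_unique[OF l] by (simp flip: w(2))
  with \<open>Re v \<ge> c\<close> show "l \<in> koenigs ` {w. c \<le> Re w}" by blast
qed

text \<open>When the two values differ by a real \<open>s\<close>, the left side of the monotonicity
  estimate bounds \<open>s * (Re b - Re a)\<close> from below by a nonnegative number; s = 0 is
  injectivity.\<close>

lemma Re_mono_koenigs:
  assumes "a \<in> \<H>" "b \<in> \<H>" "koenigs b = koenigs a + of_real s" "s \<ge> 0"
  shows "Re a \<le> Re b"
proof (cases "s = 0")
  case True
  then show ?thesis using assms inj_onD[OF inj_on_koenigs, of a b] by auto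
next
  case False
  have "0 \<le> Re ((koenigs b - koenigs a) * cnj (b - a))"
    using koenigs_monotone[OF assms(1,2)] by (rule order_trans[rotated]) simp
  then have "0 \<le> s * (Re b - Re a)" using assms(3) by simp
  then show ?thesis using False assms(4) by (simp add: zero_le_mult_iff)
qed

text \<open>
  The times at which the ray from \<open>koenigs w\<close> stays in the image form a clopen set: along the ray the
  preimage cannot move left, so the image may be replaced by that of a closed half-plane.
\<close>

lemma koenigs_image_translate:
  assumes "w \<in> \<H>" "t \<ge> 0"
  shows "koenigs w + of_real t \<in> koenigs ` \<H>"
proof -
  define r where "r s = koenigs w + of_real s" for s :: real
  define T where "T = {0..} \<inter> r -` (koenigs ` \<H>)"
  have cont: "continuous_on {0..} r" unfolding r_def by (intro continuous_intros)
  have T_eq: "T = {0..} \<inter> r -` (koenigs ` {v. Re v \<ge> Re w})"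
  proof (intro subset_antisym subsetI)
    fix s assume s: "s \<in> T"
    then obtain v where v: "v \<in> \<H>" "koenigs v = r s" by (auto simp: T_def)
    then have "Re w \<le> Re v"
      using s Re_mono_koenigs[OF assms(1)] by (auto simp: T_def r_def)
    with s v show "s \<in> {0..} \<inter> r -` (koenigs ` {v. Re v \<ge> Re w})"
      by (auto simp: T_def intro: rev_image_eqI)
  next
    fix s assume "s \<in> {0..} \<inter> r -` (koenigs ` {v. Re v \<ge> Re w})"
    then show "s \<in> T" using assms(1) by (auto simp: T_def intro: rev_image_eqI)
  qed
  have "closedin (top_of_set {0..}) T"
    unfolding T_eq using assms(1) by (intro continuous_closedin_preimage cont closed_koenigs_image) auto
  moreover have "openin (top_of_set {0..}) T"
    unfolding T_def by (intro continuous_openin_preimage_gen cont open_koenigs_image)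
  moreover have "connected {0::real..}" by simp
  moreover have "0 \<in> T" using assms(1) by (auto simp: T_def r_def)
  ultimately have "T = {0..}" by (auto simp: connected_clopen)
  then have "t \<in> T" using assms(2) by simp
  then show ?thesis by (simp add: T_def r_def)
qed


section \<open>The semigroup on the half-plane\<close>

text \<open>\<open>inv_into\<close> returns a genuine preimage only on the image of
  \<open>koenigs\<close>; for w in \<open>\<H>\<close> and t \<ge> 0 the translated point lies there
  by \<open>koenigs_image_translate\<close>.\<close>

definition flow :: "real \<Rightarrow> complex \<Rightarrow> complex"
  where "flow t w = inv_into \<H> koenigs (koenigs w + of_real t)"

lemma flow_in_hplane:
  assumes "w \<in> \<H>" "t \<ge> 0"
  shows "flow t w \<in> \<H>"
  unfolding flow_def using koenigs_image_translate[OF assms] by (rule inv_into_into)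

lemma koenigs_flow:
  assumes "w \<in> \<H>" "t \<ge> 0"
  shows "koenigs (flow t w) = koenigs w + of_real t"
  unfolding flow_def using koenigs_image_translate[OF assms] by (rule f_inv_into_f)

lemma flow_eqI:
  assumes "v \<in> \<H>" "koenigs v = koenigs w + of_real t"
  shows "flow t w = v"
  unfolding flow_def assms(2)[symmetric] using inj_on_koenigs assms(1) by (rule inv_into_f_f)

lemma flow_0: "w \<in> \<H> \<Longrightarrow> flow 0 w = w"
  by (rule flow_eqI) auto

lemma flow_add:
  assumes "w \<in> \<H>" "s \<ge> 0" "t \<ge> 0"
  shows "flow (t + s) w = flow t (flow s w)"
proof (rule flow_eqI)
  have F: "flow s w \<in> \<H>" using flow_in_hplane[OF assms(1,2)] .
  show "flow t (flow s w) \<in> \<H>" using flow_in_hplane[OF F assms(3)] .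
  show "koenigs (flow t (flow s w)) = koenigs w + of_real (t + s)"
    unfolding koenigs_flow[OF F assms(3)] koenigs_flow[OF assms(1,2)] by simp
qed

lemma Re_flow_ge:
  assumes "w \<in> \<H>" "t \<ge> 0"
  shows "Re w \<le> Re (flow t w)"
  using Re_mono_koenigs[OF assms(1) flow_in_hplane[OF assms] koenigs_flow[OF assms] assms(2)] .

text \<open>Expansion applied to two points whose Koenigs values differ by t - s. The constant does
  not depend on w, which later gives uniform convergence on the disc.\<close>

lemma flow_lipschitz:
  assumes "w \<in> \<H>" "s \<ge> 0" "t \<ge> 0"
  shows "norm (flow t w - flow s w) \<le> 2 * \<bar>t - s\<bar>"
  using koenigs_expansive[OF flow_in_hplane[OF assms(1,2)] flow_in_hplane[OF assms(1,3)]]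
  unfolding koenigs_flow[OF assms(1,2)] koenigs_flow[OF assms(1,3)]
  by (simp flip: of_real_diff)

lemma continuous_on_flow:
  assumes "w \<in> \<H>"
  shows "continuous_on {0..} (\<lambda>t. flow t w)"
proof -
  have "2-lipschitz_on {0..} (\<lambda>t. flow t w)"
    by (rule lipschitz_onI) (auto simp: dist_norm assms intro!: flow_lipschitz[OF assms, simplified])
  then show ?thesis by (rule lipschitz_on_continuous_on)
qed

lemma has_field_derivative_flow:
  assumes "w \<in> \<H>" "t \<ge> 0"
  shows "(flow t has_field_derivative koenigs' w / koenigs' (flow t w)) (at w)"
proof -
  have F: "flow t w \<in> \<H>" by (rule flow_in_hplane[OF assms])
  then have "koenigs' (flow t w) \<noteq> 0" using Re_koenigs'_ge[OF F] by force
  then have "(inv_into \<H> koenigs has_field_derivative inverse (koenigs' (flow t w)))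
      (at (koenigs (flow t w)))"
    using F holomorphic_koenigs open_hplane inj_on_koenigs
    by (intro has_field_derivative_inverse_strong[where S = \<H>] has_field_derivative_koenigs)
      (auto intro: holomorphic_on_imp_continuous_on)
  then have "(inv_into \<H> koenigs has_field_derivative inverse (koenigs' (flow t w)))
      (at (koenigs w + of_real t))"
    unfolding koenigs_flow[OF assms] .
  moreover have "((\<lambda>w. koenigs w + of_real t) has_field_derivative koenigs' w) (at w)"
    by (auto intro!: derivative_eq_intros has_field_derivative_koenigs assms)
  ultimately show ?thesis
    unfolding flow_def[abs_def] using DERIV_chain2 by (fastforce simp: divide_inverse mult.commute flow_def)
qed

section \<open>Escape to infinity and oscillation of the slope\<close>

text \<open>A crude growth bound, enough to show that trajectories leave every bounded set: the
  Koenigs value grows linearly in time.\<close>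

lemma norm_koenigs_le:
  assumes "w \<in> \<H>"
  shows "norm (koenigs w) \<le> norm w * (norm w + 3)"
proof -
  note L = Ln_hplane[OF assms]
  have pos: "Re (Ln w) > 0" using L(4) by linarith
  have "norm (osc (Ln w)) \<le> norm (Ln w)"
    using mult_left_mono[OF norm_sin_cos_Ln_le(1)[OF pos], of "norm (Ln w)"] norm_ge_zero[of "Ln w"]
    by (simp add: osc_def norm_mult norm_divide del: norm_ge_zero)
  also have "\<dots> \<le> Re (Ln w) + \<bar>Im (Ln w)\<bar>"
    using cmod_le[of "Ln w"] pos by simp
  also have "\<dots> \<le> norm w + 2"
    using L(1,3,5) pi_less_4 ln_le_minus_one[of "norm w"] by simp
  finally have "norm (1 + \<i> * osc (Ln w)) \<le> norm w + 3"
    using norm_triangle_ineq[of 1 "\<i> * osc (Ln w)"] by (simp add: norm_mult)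
  then show ?thesis unfolding koenigs_def norm_mult by (intro mult_left_mono) auto
qed

lemma flow_at_infinity:
  assumes "w \<in> \<H>"
  shows "filterlim (\<lambda>t. flow t w) at_infinity at_top"
  unfolding filterlim_at_infinity[OF order_refl]
proof (intro allI impI)
  fix r :: real assume "r > 0"
  \<comment> \<open>Beyond this time |koenigs w + t| exceeds r (r + 3), the largest value the growth
    bound allows within radius r.\<close>
  show "\<forall>\<^sub>F t in at_top. r \<le> norm (flow t w)"
    using eventually_gt_at_top[of "max 0 (r * (r + 3) + norm (koenigs w))"]
  proof eventually_elim
    case (elim t)
    then have t: "t > 0" "t > r * (r + 3) + norm (koenigs w)" by auto
    show ?case
    proof (rule ccontr)
      assume "\<not> r \<le> norm (flow t w)"
      then have "norm (flow t w) * (norm (flow t w) + 3) \<le> r * (r + 3)"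
        using \<open>r > 0\<close> by (intro mult_mono) auto
      then have "norm (koenigs w + of_real t) \<le> r * (r + 3)"
        using norm_koenigs_le[OF flow_in_hplane[OF assms, of t]] t koenigs_flow[OF assms, of t] by simp
      then show False using t norm_diff_ineq[of "of_real t" "koenigs w"] by (simp add: add.commute)
    qed
  qed
qed

text \<open>
  The imaginary part of \<open>koenigs v / Re v\<close> is \<open>Re (osc (Ln v)) + (Im v / Re v) (1 - Im (osc (Ln v)))\<close>.
\<close>

lemma slope_koenigs:
  assumes "v \<in> \<H>"
  defines "s \<equiv> ln (norm v) * sin (ln (ln (norm v))) / 100"
  assumes "m \<ge> 0"
  shows "s \<ge> \<bar>Im (koenigs v)\<bar> + 1 + 2 * m \<Longrightarrow> Im v / Re v \<le> - m"
    and "- s \<ge> \<bar>Im (koenigs v)\<bar> + 1 + 2 * m \<Longrightarrow> Im v / Re v \<ge> m"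
proof -
  note L = Ln_hplane[OF assms(1)]
  have pos: "Re (Ln v) > 0" using L(4) by linarith
  define e where "e = 1 - Im (osc (Ln v))"
  define p where "p = Re (osc (Ln v))"
  have e: "0 < e" "e \<le> 2" using abs_Im_osc_le[OF pos L(5)] by (auto simp: e_def)
  have p: "\<bar>p - s\<bar> \<le> 3 / 10" using Re_osc_near[OF pos L(5)] by (simp add: p_def s_def L(3))
  have v: "Re v > 3" using assms(1) by simp
  have "Im (koenigs v) = Re v * p + Im v * e"
    by (simp add: koenigs_def p_def e_def)
  then have "Im v / Re v * e + p = Im (koenigs v) / Re v"
    using v by (simp add: field_simps)
  moreover have "\<bar>Im (koenigs v) / Re v\<bar> \<le> \<bar>Im (koenigs v)\<bar>"
    using v mult_left_mono[of 1 "Re v" "\<bar>Im (koenigs v)\<bar>"] by (simp add: abs_divide divide_le_eq)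
  \<comment> \<open>The summand 1 absorbs the error 3/10 between p and s. The factor 2 of m in the
    hypotheses below pays for e \<le> 2.\<close>
  ultimately have q: "\<bar>Im v / Re v * e + s\<bar> \<le> \<bar>Im (koenigs v)\<bar> + 1" using p by linarith
  have me: "m * e \<le> m * 2" using e assms(3) by (intro mult_left_mono) auto
  show "Im v / Re v \<le> - m" if "s \<ge> \<bar>Im (koenigs v)\<bar> + 1 + 2 * m"
  proof -
    have "Im v / Re v * e \<le> (- m) * e" using q that me by linarith
    then show ?thesis using e by (simp only: mult_le_cancel_right_pos)
  qed
  show "Im v / Re v \<ge> m" if "- s \<ge> \<bar>Im (koenigs v)\<bar> + 1 + 2 * m"
  proof -
    have "m * e \<le> Im v / Re v * e" using q that me by linarith
    then show ?thesis using e by (simp only: mult_le_cancel_right_pos)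
  qed
qed

text \<open>Adding periods to \<open>ln y\<close> gives the witness exp (d + 2 n pi); with d \<ge> 0
  it is at least n.\<close>

lemma ex_ge_sin_ln_eq:
  fixes B d :: real
  assumes "d \<ge> 0"
  obtains y where "y \<ge> B" "sin (ln y) = sin d"
proof -
  obtain n :: nat where n: "real n \<ge> B" using real_arch_simple by blast
  have "real n \<le> 2 * real n * pi"
    using mult_left_mono[of 1 "2 * pi" "real n"] pi_gt3 by simp
  also have "\<dots> \<le> exp (d + 2 * real n * pi)"
    using exp_ge_add_one_self[of "d + 2 * real n * pi"] assms by linarith
  finally have "B \<le> exp (d + 2 * real n * pi)" using n by linarith
  moreover have "sin (ln (exp (d + 2 * real n * pi))) = sin d"
    by (simp add: sin_add del: mult_2)
  ultimately show ?thesis using that by blast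
qed

text \<open>Intermediate value theorem along an escaping trajectory. Late times can thus be selected
  by the norm, which is what the oscillation depends on.\<close>

lemma flow_norm_attained:
  assumes "w \<in> \<H>" "T \<ge> 0" "y \<ge> ln (norm (flow T w))"
  obtains t where "t \<ge> T" "ln (norm (flow t w)) = y"
proof -
  have "\<forall>\<^sub>F t in at_top. exp y \<le> norm (flow t w)"
    using flow_at_infinity[OF assms(1)] unfolding filterlim_at_infinity[OF order_refl] by simp
  then obtain t\<^sub>1 where t\<^sub>1: "t\<^sub>1 \<ge> T" "exp y \<le> norm (flow t\<^sub>1 w)"
    by (metis eventually_at_top_linorder nle_le)
  have nz: "flow t w \<noteq> 0" if "t \<ge> T" for t
    using Ln_hplane(1)[OF flow_in_hplane[OF assms(1), of t]] that assms(2) by auto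
  have "\<exists>t\<ge>T. t \<le> t\<^sub>1 \<and> ln (norm (flow t w)) = y"
  proof (rule IVT')
    show "y \<le> ln (norm (flow t\<^sub>1 w))"
      using t\<^sub>1 nz by (simp add: ln_ge_iff)
    show "continuous_on {T..t\<^sub>1} (\<lambda>t. ln (norm (flow t w)))"
      using nz assms(2) by (intro continuous_intros continuous_on_subset[OF continuous_on_flow[OF assms(1)]]) auto
  qed (use assms t\<^sub>1 in auto)
  then show ?thesis using that by blast
qed

lemma slope_attained:
  assumes "w \<in> \<H>"
  obtains t where "t > T" "t > 0" "Im (flow t w) / Re (flow t w) = c"
proof -
  define T' where "T' = max T 0 + 1"
  define q where "q t = Im (flow t w) / Re (flow t w)" for t
  \<comment> \<open>The factor 100 cancels the divisor in \<open>osc\<close>: once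
    \<open>ln (norm v)\<close> is at least A and the sine is 1 or -1, \<open>slope_koenigs\<close>
    applies with m = |c|.\<close>
  define A where "A = 100 * (\<bar>Im (koenigs w)\<bar> + 1 + 2 * \<bar>c\<bar>)"
  have H: "flow t w \<in> \<H>" "Im (koenigs (flow t w)) = Im (koenigs w)" if "t \<ge> T'" for t
    using that flow_in_hplane[OF assms, of t] koenigs_flow[OF assms, of t] by (auto simp: T'_def)
  obtain y\<^sub>1 where y\<^sub>1: "y\<^sub>1 \<ge> max A (ln (norm (flow T' w)))" "sin (ln y\<^sub>1) = 1"
    using ex_ge_sin_ln_eq[of "pi / 2" "max A (ln (norm (flow T' w)))"] by auto
  have "0 \<le> 3 / 2 * pi" by simp
  then obtain y\<^sub>2 where y\<^sub>2: "y\<^sub>2 \<ge> max A (ln (norm (flow T' w)))" "sin (ln y\<^sub>2) = - 1"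
    using ex_ge_sin_ln_eq[OF \<open>0 \<le> 3 / 2 * pi\<close>, unfolded sin_3over2_pi] by blast
  have "T' \<ge> 0" by (simp add: T'_def)
  obtain t\<^sub>1 where t\<^sub>1: "t\<^sub>1 \<ge> T'" "ln (norm (flow t\<^sub>1 w)) = y\<^sub>1"
    using flow_norm_attained[OF assms \<open>T' \<ge> 0\<close>, of y\<^sub>1] y\<^sub>1(1) by auto
  obtain t\<^sub>2 where t\<^sub>2: "t\<^sub>2 \<ge> T'" "ln (norm (flow t\<^sub>2 w)) = y\<^sub>2"
    using flow_norm_attained[OF assms \<open>T' \<ge> 0\<close>, of y\<^sub>2] y\<^sub>2(1) by auto
  have "q t\<^sub>1 \<le> - \<bar>c\<bar>" unfolding q_def
    by (rule slope_koenigs(1)[OF H(1)]) (use y\<^sub>1 t\<^sub>1 H in \<open>auto simp: A_def\<close>)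
  moreover have "q t\<^sub>2 \<ge> \<bar>c\<bar>" unfolding q_def
    by (rule slope_koenigs(2)[OF H(1)]) (use y\<^sub>2 t\<^sub>2 H in \<open>auto simp: A_def\<close>)
  ultimately have "c \<in> {q t\<^sub>1..q t\<^sub>2}" by auto
  moreover have "continuous_on {T'..} q"
    unfolding q_def using H(1) \<open>T' \<ge> 0\<close>
    by (intro continuous_intros continuous_on_subset[OF continuous_on_flow[OF assms]]) force+
  \<comment> \<open>The order of the two times is unknown, so connectedness of the image of the
    whole ray replaces the intermediate value theorem on an interval.\<close>
  then have "connected (q ` {T'..})" by (intro connected_continuous_image) auto
  then have "{q t\<^sub>1..q t\<^sub>2} \<subseteq> q ` {T'..}"
    using t\<^sub>1 t\<^sub>2 by (intro connected_contains_Icc) auto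
  ultimately obtain t where "t \<ge> T'" "q t = c" by auto
  then show ?thesis using that[of t] by (auto simp: q_def T'_def)
qed


section \<open>Transfer to the disc: semigroup, Denjoy-Wolff point and parabolicity\<close>

lemma disc_to_hplane:
  assumes "z \<in> \<D>"
  shows "6 / (1 - z) \<in> \<H>" "z \<noteq> 1"
proof -
  show "z \<noteq> 1" using assms by auto
  then have pos: "(1 - Re z)\<^sup>2 + (Im z)\<^sup>2 > 0"
    by (auto simp: sum_power2_gt_zero_iff complex_eq_iff)
  have "(Re z)\<^sup>2 + (Im z)\<^sup>2 < 1"
    using assms by (simp add: cmod_def)
  then have "3 * ((1 - Re z)\<^sup>2 + (Im z)\<^sup>2) < 6 * (1 - Re z)"
    by (simp add: power2_eq_square algebra_simps)
  then show "6 / (1 - z) \<in> \<H>" using pos by (simp add: Re_divide less_divide_eq)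
qed

text \<open>The point equals (w - 6)/w, and Re w > 3 says that w is closer to 6 than to 0.\<close>

lemma hplane_to_disc:
  assumes "w \<in> \<H>"
  shows "1 - 6 / w \<in> \<D>"
proof -
  have "w \<noteq> 0" using assms by auto
  have "(norm (w - 6))\<^sup>2 < (norm w)\<^sup>2"
    using assms unfolding cmod_power2 by (simp add: power2_eq_square algebra_simps)
  then have "norm (w - 6) < norm w" by (rule power_less_imp_less_base) simp
  then have "norm ((w - 6) / w) < 1" using \<open>w \<noteq> 0\<close> by (simp add: norm_divide)
  then show ?thesis using \<open>w \<noteq> 0\<close> by (simp add: diff_divide_distrib)
qed

definition disc_flow :: "real \<Rightarrow> complex \<Rightarrow> complex"
  where "disc_flow t z = 1 - 6 / flow t (6 / (1 - z))"

lemma disc_flow_in_disc: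
  assumes "z \<in> \<D>" "t \<ge> 0"
  shows "disc_flow t z \<in> \<D>"
  unfolding disc_flow_def
  by (intro hplane_to_disc flow_in_hplane disc_to_hplane assms)

text \<open>The outer maps contribute w^2/6 and 6 over the square of \<open>flow t w\<close>.
  Grouping the factors into ratios prepares the radial limit, where each ratio tends to 1.\<close>

lemma has_field_derivative_disc_flow:
  assumes "z \<in> \<D>" "t \<ge> 0"
  defines "w \<equiv> 6 / (1 - z)"
  shows "(disc_flow t has_field_derivative
    (w / flow t w)\<^sup>2 * (koenigs' w / koenigs' (flow t w))) (at z)"
proof -
  have w: "w \<in> \<H>" and z: "z \<noteq> 1" unfolding w_def using disc_to_hplane[OF assms(1)] .
  have "flow t w \<noteq> 0" using Ln_hplane(1)[OF flow_in_hplane[OF w assms(2)]] .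
  have "((\<lambda>z. 6 / (1 - z)) has_field_derivative w\<^sup>2 / 6) (at z)"
    using z by (auto intro!: derivative_eq_intros simp: w_def power2_eq_square)
  then have "((\<lambda>z. flow t (6 / (1 - z))) has_field_derivative
      koenigs' w / koenigs' (flow t w) * (w\<^sup>2 / 6)) (at z)"
    using has_field_derivative_flow[OF w assms(2)] unfolding w_def by (rule DERIV_chain2[rotated])
  then show ?thesis
    unfolding disc_flow_def[abs_def] using \<open>flow t w \<noteq> 0\<close>
    by (auto intro!: derivative_eq_intros simp: w_def[symmetric] power2_eq_square mult_ac)
qed

lemma one_parameter_semigroup_disc_flow: "one_parameter_semigroup disc_flow"
  unfolding one_parameter_semigroup_def
proof (intro conjI ballI allI impI)
  fix t :: real assume "t \<ge> 0"
  then show "disc_flow t \<in> Hol_disc"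
    unfolding Hol_disc_def holomorphic_on_open[OF open_ball]
    using has_field_derivative_disc_flow disc_flow_in_disc by blast
next
  fix z assume "z \<in> \<D>"
  then show "disc_flow 0 z = z"
    using disc_to_hplane[of z] by (simp add: disc_flow_def flow_0 diff_divide_distrib)
next
  fix s t :: real and z assume "s \<ge> 0" "t \<ge> 0" "z \<in> \<D>"
  then show "disc_flow (t + s) z = disc_flow t (disc_flow s z)"
    using flow_add[OF disc_to_hplane(1)] by (simp add: disc_flow_def)
next
  fix t\<^sub>0 :: real and K assume "t\<^sub>0 \<ge> 0" and K: "compact K \<and> K \<subseteq> \<D>"
  \<comment> \<open>With a and b the two flow values, the difference is 6 (a - b)/(a b), and |a| |b|
    \<ge> 9 > 6, so the Lipschitz bound in time carries over.\<close>
  have le: "norm (disc_flow t z - disc_flow t\<^sub>0 z) \<le> 2 * \<bar>t - t\<^sub>0\<bar>" if "t \<ge> 0" "z \<in> \<D>" for t z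
  proof -
    define a where "a = flow t (6 / (1 - z))"
    define b where "b = flow t\<^sub>0 (6 / (1 - z))"
    note w = disc_to_hplane(1)[OF that(2)]
    have H: "a \<in> \<H>" "b \<in> \<H>"
      unfolding a_def b_def by (intro flow_in_hplane w that(1) \<open>t\<^sub>0 \<ge> 0\<close>)+
    have nz: "a \<noteq> 0" "b \<noteq> 0" using Ln_hplane(1) H by auto
    have "norm a \<ge> 3" "norm b \<ge> 3"
      using H complex_Re_le_cmod[of a] complex_Re_le_cmod[of b] by auto
    then have "3 * 3 \<le> norm a * norm b" by (intro mult_mono) auto
    then have "6 * norm (a - b) \<le> norm (a - b) * (norm a * norm b)"
      using mult_left_mono[of 6 "norm a * norm b" "norm (a - b)"] by (simp add: mult.commute)
    moreover have "disc_flow t z - disc_flow t\<^sub>0 z = 6 * (a - b) / (a * b)"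
      using nz by (simp add: disc_flow_def a_def[symmetric] b_def[symmetric] field_simps)
    ultimately have "norm (disc_flow t z - disc_flow t\<^sub>0 z) \<le> norm (a - b)"
      using nz by (simp add: norm_divide norm_mult divide_le_eq del: right_diff_distrib_numeral)
    also have "\<dots> \<le> 2 * \<bar>t - t\<^sub>0\<bar>"
      unfolding a_def b_def by (rule flow_lipschitz[OF w \<open>t\<^sub>0 \<ge> 0\<close> that(1)])
    finally show ?thesis .
  qed
  show "uniform_limit K disc_flow (disc_flow t\<^sub>0) (at t\<^sub>0 within {0..})"
  proof (rule uniform_limitI)
    fix e :: real assume "e > 0"
    have "dist (disc_flow t z) (disc_flow t\<^sub>0 z) < e"
      if "t \<ge> 0" "dist t t\<^sub>0 < e / 2" "z \<in> K" for t z
      using le[of t z] that K by (auto simp: dist_norm)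
    then show "\<forall>\<^sub>F t in at t\<^sub>0 within {0..}. \<forall>z\<in>K. dist (disc_flow t z) (disc_flow t\<^sub>0 z) < e"
      unfolding eventually_at using \<open>e > 0\<close> by (intro exI[of _ "e / 2"]) auto
  qed
qed

text \<open>A fixed point at time 1 would give a Koenigs value equal to itself plus 1.\<close>

lemma nonelliptic_disc_flow: "nonelliptic_semigroup disc_flow"
  unfolding nonelliptic_semigroup_def
proof (intro conjI exI[of _ 1] notI)
  assume "\<exists>z\<in>\<D>. disc_flow 1 z = z"
  then obtain z where z: "z \<in> \<D>" "disc_flow 1 z = z" by blast
  define w where "w = 6 / (1 - z)"
  have w: "w \<in> \<H>" unfolding w_def by (rule disc_to_hplane(1)[OF z(1)])
  have "flow 1 w = w"
    using z disc_to_hplane(2)[OF z(1)] Ln_hplane(1)[OF flow_in_hplane[OF w, of 1]]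
    by (simp add: disc_flow_def w_def[symmetric]) (simp add: w_def field_simps)
  then show False using koenigs_flow[OF w, of 1] by simp
qed (simp_all add: one_parameter_semigroup_disc_flow)

lemma Denjoy_Wolff_disc_flow: "Denjoy_Wolff_point disc_flow 1"
  unfolding Denjoy_Wolff_point_def
proof (intro conjI ballI)
  fix z assume "z \<in> \<D>"
  then have "((\<lambda>t. 1 - 6 / flow t (6 / (1 - z))) \<longlongrightarrow> 1 - 0) at_top"
    by (intro tendsto_diff tendsto_const tendsto_divide_0[OF tendsto_const] flow_at_infinity
        disc_to_hplane)
  then show "((\<lambda>t. disc_flow t z) \<longlongrightarrow> 1) at_top" by (simp add: disc_flow_def)
qed simp

text \<open>On the radius, w = x = 6/(1 - r) is real and the flow moves it by at most 2t. Both
  ratios in the derivative therefore differ from 1 by O(t/x), that is O(t (1 - r)).\<close>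

lemma spectral_value_disc_flow: "spectral_value disc_flow 1 0"
  unfolding spectral_value_def
proof (intro conjI allI impI)
  fix t :: real assume t: "t \<ge> 0"
  define w where "w r = 6 / (1 - complex_of_real r)" for r
  define v where "v r = flow t (w r)" for r
  have r: "\<forall>\<^sub>F r in at_left (1::real). 0 < r \<and> r < 1"
    unfolding eventually_at_left_field by (intro exI[of _ 0]) auto
  have D: "complex_of_real r \<in> \<D>" if "0 < r \<and> r < 1" for r
    using that by simp
  have lim: "((\<lambda>r. t * (1 - r)) \<longlongrightarrow> 0) (at_left 1)"
    by (auto intro!: tendsto_eq_intros)
  have close: "norm (w r / v r - 1) \<le> t * (1 - r)"
    "norm (koenigs' (w r) / koenigs' (v r) - 1) \<le> t * (1 - r)" if r: "0 < r \<and> r < 1" for r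
  proof -
    note w = disc_to_hplane(1)[OF D[OF r], folded w_def]
    note v = flow_in_hplane[OF w t, folded v_def]
    define x where "x = 6 / (1 - r)"
    have wx: "w r = of_real x" by (simp add: w_def x_def)
    have x: "x > 3" using w by (simp add: wx)
    \<comment> \<open>The flow does not move left, so both points lie in \<open>Re \<ge> x\<close>,
      where \<open>koenigs'\<close> has Lipschitz constant 1/x.\<close>
    have vx: "Re (v r) \<ge> x" using Re_flow_ge[OF w t] by (simp add: wx v_def)
    then have nv: "norm (v r) \<ge> x" using complex_Re_le_cmod[of "v r"] by linarith
    have d: "norm (v r - w r) \<le> 2 * t"
      using flow_lipschitz[OF w order_refl t] flow_0[OF w] t by (simp add: v_def)
    have e: "t * (1 - r) = 6 * t / x" by (simp add: x_def)
    have e2: "2 * t / x \<le> 6 * t / x" "2 * t / x / (1 / 2) \<le> 6 * t / x"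
      using t x by (auto intro: divide_right_mono)
    have "norm (w r / v r - 1) = norm (v r - w r) / norm (v r)"
      using nv x by (subst norm_minus_commute) (auto simp: norm_divide[symmetric] diff_divide_distrib)
    also have "\<dots> \<le> 2 * t / x" using d nv x t by (intro frac_le) auto
    finally show "norm (w r / v r - 1) \<le> t * (1 - r)" using e e2(1) by linarith
    have k: "norm (koenigs' (v r)) \<ge> 1 / 2"
      using Re_koenigs'_ge[OF v] complex_Re_le_cmod[of "koenigs' (v r)"] by linarith
    have "norm (koenigs' (v r) - koenigs' (w r)) \<le> 1 / x * norm (v r - w r)"
      by (rule koenigs'_diff_le) (use x vx in \<open>auto simp: wx\<close>)
    also have "\<dots> \<le> 1 / x * (2 * t)" using d x by (intro mult_left_mono) auto
    finally have kd: "norm (koenigs' (v r) - koenigs' (w r)) \<le> 2 * t / x" by simp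
    have "norm (koenigs' (w r) / koenigs' (v r) - 1)
        = norm (koenigs' (v r) - koenigs' (w r)) / norm (koenigs' (v r))"
      using k by (subst norm_minus_commute) (auto simp: norm_divide[symmetric] diff_divide_distrib)
    also have "\<dots> \<le> (2 * t / x) / (1 / 2)" using kd k t x by (intro frac_le) auto
    finally show "norm (koenigs' (w r) / koenigs' (v r) - 1) \<le> t * (1 - r)" using e e2(2) by linarith
  qed
  have "((\<lambda>r. w r / v r - 1) \<longlongrightarrow> 0) (at_left 1)"
    "((\<lambda>r. koenigs' (w r) / koenigs' (v r) - 1) \<longlongrightarrow> 0) (at_left 1)"
    using r by (auto intro!: Lim_null_comparison[OF _ lim] close elim!: eventually_mono)
  then have "((\<lambda>r. w r / v r) \<longlongrightarrow> 1) (at_left 1)"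
    "((\<lambda>r. koenigs' (w r) / koenigs' (v r)) \<longlongrightarrow> 1) (at_left 1)"
    by (simp_all add: LIM_zero_iff)
  then have "((\<lambda>r. (w r / v r)\<^sup>2 * (koenigs' (w r) / koenigs' (v r))) \<longlongrightarrow> 1\<^sup>2 * 1) (at_left 1)"
    by (intro tendsto_intros)
  moreover have "\<forall>\<^sub>F r in at_left 1. deriv (disc_flow t) (of_real r * 1)
      = (w r / v r)\<^sup>2 * (koenigs' (w r) / koenigs' (v r))"
    using r
  proof eventually_elim
    case (elim r)
    then show ?case
      using DERIV_imp_deriv[OF has_field_derivative_disc_flow[OF D t]] by (simp add: w_def v_def)
  qed
  ultimately show "((\<lambda>r. deriv (disc_flow t) (of_real r * 1)) \<longlongrightarrow> of_real (exp (- 0 * t))) (at_left 1)"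
    by (subst tendsto_cong) simp_all
qed simp

lemma parabolic_disc_flow: "parabolic_semigroup disc_flow"
  unfolding parabolic_semigroup_def
  using nonelliptic_disc_flow Denjoy_Wolff_disc_flow spectral_value_disc_flow by blast

section \<open>The set of slopes\<close>

lemma strict_mono_sequence_to_limit_point:
  fixes f :: "real \<Rightarrow> 'a::metric_space"
  assumes "\<And>e T. e > 0 \<Longrightarrow> \<exists>t>T. dist (f t) l < e"
  obtains t :: "nat \<Rightarrow> real" where
    "strict_mono t" "\<And>n. t n > 0" "filterlim t at_top sequentially" "(\<lambda>n. f (t n)) \<longlonglongrightarrow> l"
proof -
  \<comment> \<open>The strict inequality \<open>x > real n\<close> gives both positivity of all
    terms and divergence; the choice below adds monotonicity.\<close>
  define P where "P n x \<longleftrightarrow> x > real n \<and> dist (f x) l < inverse (real (Suc n))" for n x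
  have "\<exists>t. \<forall>n. P n (t n) \<and> t n < t (Suc n)"
  proof (rule dependent_nat_choice)
    show "\<exists>x. P 0 x" using assms[of 1 0] by (auto simp: P_def)
    show "\<exists>y. P (Suc n) y \<and> x < y" for n x
      using assms[of "inverse (real (Suc (Suc n)))" "max x (real (Suc n))"] by (auto simp: P_def)
  qed
  then obtain t where t: "\<And>n. P n (t n)" "\<And>n. t n < t (Suc n)" by blast
  have "strict_mono t" using t(2) by (simp add: strict_mono_Suc_iff)
  moreover have "t n > 0" for n using t(1)[of n] by (auto simp: P_def)
  moreover have "filterlim t at_top sequentially"
    by (rule filterlim_at_top_mono[OF filterlim_real_sequentially])
      (use t(1) in \<open>auto simp: P_def less_imp_le intro!: always_eventually\<close>)
  moreover have "(\<lambda>n. dist (f (t n)) l) \<longlonglongrightarrow> 0"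
    by (rule Lim_null_comparison[OF _ LIMSEQ_inverse_real_of_nat])
      (use t(1) in \<open>auto simp: P_def less_imp_le intro!: always_eventually\<close>)
  then have "(\<lambda>n. f (t n)) \<longlonglongrightarrow> l" by (rule tendsto_dist_iff[THEN iffD2])
  ultimately show ?thesis using that by blast
qed

lemma Slope_plus_disc_flow:
  assumes "z \<in> \<D>"
  shows "Slope_plus disc_flow z 1 = {- pi / 2 .. pi / 2}"
proof (intro subset_antisym subsetI)
  fix \<theta> assume \<theta>: "\<theta> \<in> {- pi / 2 .. pi / 2}"
  define w where "w = 6 / (1 - z)"
  have w: "w \<in> \<H>" unfolding w_def by (rule disc_to_hplane(1)[OF assms])
  have "\<exists>t>T. dist (Arg (1 - cnj 1 * disc_flow t z)) \<theta> < e" if "e > 0" for e T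
  proof -
    \<comment> \<open>The endpoints are not values of the argument here, so the target is shifted
      towards the interior by less than e; d \<le> 1 < pi/2 keeps it from crossing to the other
      end.\<close>
    define d where "d = min (e / 2) 1"
    define \<theta>' where "\<theta>' = (if \<theta> > 0 then \<theta> - d else \<theta> + d)"
    have \<theta>': "- (pi / 2) < \<theta>'" "\<theta>' < pi / 2" "dist \<theta>' \<theta> < e"
      using \<theta> that pi_gt3 by (auto simp: \<theta>'_def d_def dist_real_def)
    \<comment> \<open>The sign is reversed because 1 - \<open>disc_flow t z\<close> equals 6/v,
      whose slope is minus that of v.\<close>
    obtain t where t: "t > T" "t > 0" "Im (flow t w) / Re (flow t w) = - tan \<theta>'"
      using slope_attained[OF w] .
    define v where "v = flow t w"
    have v: "Re v > 3" "v \<noteq> 0" using flow_in_hplane[OF w, of t] t(2) by (auto simp: v_def)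
    have "Re (6 / v) = 6 * Re v / (norm v)\<^sup>2" "Im (6 / v) = - 6 * Im v / (norm v)\<^sup>2"
      by (simp_all add: Re_divide Im_divide cmod_power2)
    moreover have "(norm v)\<^sup>2 > 0" using v by simp
    ultimately have "Re (6 / v) > 0" "Im (6 / v) / Re (6 / v) = - (Im v / Re v)"
      using v by simp_all
    then have "Arg (6 / v) = arctan (tan \<theta>')"
      using t(3) by (simp add: arg_conv_arctan v_def)
    also have "\<dots> = \<theta>'" using \<theta>' by (intro arctan_tan) auto
    finally have "Arg (1 - cnj 1 * disc_flow t z) = \<theta>'"
      by (simp add: disc_flow_def v_def w_def)
    then show ?thesis using t(1) \<theta>'(3) by blast
  qed
  then obtain t where "strict_mono t" "\<And>n. t n > 0" "filterlim t at_top sequentially"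
    "(\<lambda>n. Arg (1 - cnj 1 * disc_flow (t n) z)) \<longlonglongrightarrow> \<theta>"
    using strict_mono_sequence_to_limit_point[of "\<lambda>t. Arg (1 - cnj 1 * disc_flow t z)" \<theta>] by blast
  then show "\<theta> \<in> Slope_plus disc_flow z 1"
    unfolding Slope_plus_def using \<theta> by blast
qed (simp add: Slope_plus_def)

theorem theorem1p1:
  shows "(\<exists>\<phi> :: real \<Rightarrow> complex \<Rightarrow> complex.
            parabolic_semigroup \<phi> \<and> Denjoy_Wolff_point \<phi> 1 \<and>
            (\<forall>z\<in>\<D>. Slope_plus \<phi> z 1 = {- pi / 2 .. pi / 2}))
         \<and> \<not> parabolic_slope_conjecture"
proof (intro conjI exI[of _ disc_flow] ballI)
  show "\<not> parabolic_slope_conjecture"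
  proof
    assume parabolic_slope_conjecture
    then obtain \<theta> where "\<forall>z\<in>\<D>. Slope_plus disc_flow z 1 = {\<theta>}"
      unfolding parabolic_slope_conjecture_def
      using parabolic_disc_flow Denjoy_Wolff_disc_flow by blast
    then have "{- pi / 2 .. pi / 2} = {\<theta>}"
      using Slope_plus_disc_flow[of 0] by simp
    then have "- pi / 2 = pi / 2" by (metis atLeastAtMost_singleton_iff)
    then show False by simp
  qed
qed (simp_all add: parabolic_disc_flow Denjoy_Wolff_disc_flow Slope_plus_disc_flow)

end
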